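(* Let $\Re$ be a complete and reduced rewriting system over $\Sigma$ that is cyclically terminating. If there are no rules in $\Re$ with cyclical overlaps or cyclical inclusions, then $\Re$ is cyclically confluent.
   Context: A rewriting system $\Re$ over $\Sigma$ is a (possibly infinite) set of rules $l\rightarrow r$ with $l,r\in\Sigma^{*}$; one writes $plq\rightarrow prq$ for a rule $l\rightarrow r$ and words $p,q$. It is complete if terminating and confluent; reduced if for every rule $l\rightarrow r$ the word $r$ is irreducible and no other rule has its left-hand side a subword of $l$. Words $u,v$ are cyclic conjugates, $u\bumpeq v$, if $u=pq$ and $v=qp$ in $\Sigma^{*}$ for some (possibly empty) words $p,q$. One writes $u\looparrowright v$ if there is $\widetilde u\bumpeq u$ with $\widetilde u\rightarrow v$ (one rewriting step); $\looparrowright^{*}$ is the reflexive transitive closure. $\Re$ is cyclically terminating if there is no infinite sequence $u_1\looparrowright u_2\looparrowright\cdots$. $\Re$ is cyclically confluent if whenever $w\looparrowright^{*}u$ and $w\looparrowright^{*}v$ there are words $z\bumpeq z'$ with $u\looparrowright^{*}z$ and $v\looparrowright^{*}z'$. Cyclical overlap: there are rules $xuy\rightarrow u'$ and $yvx\rightarrow v'$ in $\Re$ (not required to be distinct), where $u',v'$ are words, $u,v,x,y$ are non-empty words, and $u'v$ and $v'u$ are not cyclic conjugates. Cyclical inclusion: there are rules $l\rightarrow v$ and $l'\rightarrow v'$ in $\Re$ such that either (a) $l'$ is a cyclic conjugate of $l$, and $v,v'$ are not cyclic conjugates; or (b) $l'$ is a proper subword of a cyclic conjugate of $l$, so that some cyclic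 conjugate of $l$ has the form $ul'$ with $u$ a non-empty word, and $v$ and $uv'$ are not cyclic conjugates. *)

theory Defs
  imports Main "HOL-Library.Sublist" "HOL-Library.Confluence"
begin

text \<open>The alphabet is the type \<^typ>\<open>'a\<close>, a word is a list, and a pair \<open>(l, r)\<close> stands for the
  rule \<open>l \<rightarrow> r\<close>.\<close>

type_synonym 'a rewriting_system = "('a list \<times> 'a list) set"

definition rstep :: "'a rewriting_system \<Rightarrow> 'a list \<Rightarrow> 'a list \<Rightarrow> bool" where
  "rstep R s t \<longleftrightarrow> (\<exists>p q l r. (l, r) \<in> R \<and> s = p @ l @ q \<and> t = p @ r @ q)"

definition no_infinite_chain :: "('b \<Rightarrow> 'b \<Rightarrow> bool) \<Rightarrow> bool" where
  "no_infinite_chain rel \<longleftrightarrow> \<not> (\<exists>f :: nat \<Rightarrow> 'b. \<forall>i. rel (f i) (f (Suc i)))"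

definition terminating :: "'a rewriting_system \<Rightarrow> bool" where
  "terminating R \<longleftrightarrow> no_infinite_chain (rstep R)"

definition complete_system :: "'a rewriting_system \<Rightarrow> bool" where
  "complete_system R \<longleftrightarrow> terminating R \<and> confluentp (rstep R)"

definition irreducible_word :: "'a rewriting_system \<Rightarrow> 'a list \<Rightarrow> bool" where
  "irreducible_word R w \<longleftrightarrow> \<not> (\<exists>w'. rstep R w w')"

definition reduced_system :: "'a rewriting_system \<Rightarrow> bool" where
  "reduced_system R \<longleftrightarrow>
     (\<forall>l r. (l, r) \<in> R \<longrightarrow>
        irreducible_word R r \<and>
        \<not> (\<exists>l' r'. (l', r') \<in> R \<and> (l', r') \<noteq> (l, r) \<and> sublist l' l))"

definition cyclic_conjugate :: "'a list \<Rightarrow> 'a list \<Rightarrow> bool" where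
  "cyclic_conjugate u v \<longleftrightarrow> (\<exists>p q. u = p @ q \<and> v = q @ p)"

definition cyclic_step :: "'a rewriting_system \<Rightarrow> 'a list \<Rightarrow> 'a list \<Rightarrow> bool" where
  "cyclic_step R u v \<longleftrightarrow> (\<exists>u'. cyclic_conjugate u' u \<and> rstep R u' v)"

definition cyclically_terminating :: "'a rewriting_system \<Rightarrow> bool" where
  "cyclically_terminating R \<longleftrightarrow> no_infinite_chain (cyclic_step R)"

definition cyclically_confluent :: "'a rewriting_system \<Rightarrow> bool" where
  "cyclically_confluent R \<longleftrightarrow>
     (\<forall>w u v. (cyclic_step R)\<^sup>*\<^sup>* w u \<and> (cyclic_step R)\<^sup>*\<^sup>* w v \<longrightarrow>
        (\<exists>z z'. cyclic_conjugate z z' \<and> (cyclic_step R)\<^sup>*\<^sup>* u z \<and> (cyclic_step R)\<^sup>*\<^sup>* v z'))"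

definition has_cyclical_overlap :: "'a rewriting_system \<Rightarrow> bool" where
  "has_cyclical_overlap R \<longleftrightarrow>
     (\<exists>x y u v u' v'. (x @ u @ y, u') \<in> R \<and> (y @ v @ x, v') \<in> R \<and>
        u \<noteq> [] \<and> v \<noteq> [] \<and> x \<noteq> [] \<and> y \<noteq> [] \<and>
        \<not> cyclic_conjugate (u' @ v) (v' @ u))"

text \<open>In the second disjunct, a proper subword \<open>l'\<close> of a cyclic conjugate of \<open>l\<close> is a proper
  suffix of another cyclic conjugate \<open>u @ l'\<close> of \<open>l\<close>.\<close>

definition has_cyclical_inclusion :: "'a rewriting_system \<Rightarrow> bool" where
  "has_cyclical_inclusion R \<longleftrightarrow>
     (\<exists>l v l' v'. (l, v) \<in> R \<and> (l', v') \<in> R \<and>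
        (cyclic_conjugate l' l \<and> \<not> cyclic_conjugate v v' \<or>
         (\<exists>u. u \<noteq> [] \<and> cyclic_conjugate (u @ l') l \<and> \<not> cyclic_conjugate v (u @ v'))))"

end

theory Submission
  imports Defs
begin

text \<open>
  Cyclic steps do not distinguish between cyclic conjugates, so Newman's lemma holds modulo
  conjugacy and local confluence suffices. Two redexes of a cyclic word are two arcs of a circle. If
  the circle can be cut at a point interior to neither arc, both redexes live in an ordinary word and
  confluence of the system applies. Otherwise the arcs cover the circle and meet at both ends, so
  the left-hand sides are \<open>x @ u @ y\<close> and \<open>y @ v @ x\<close> with \<open>x\<close> and \<open>y\<close> non-empty. According to which
  of \<open>u\<close>, \<open>v\<close> are empty this is the configuration of a cyclical overlap or of a cyclical inclusion,
  and its absence says precisely that the two results are cyclic conjugates.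
\<close>

section \<open>Newman's lemma modulo an equivalence\<close>

definition joinable_modulo :: "('b \<Rightarrow> 'b \<Rightarrow> bool) \<Rightarrow> ('b \<Rightarrow> 'b \<Rightarrow> bool) \<Rightarrow> 'b \<Rightarrow> 'b \<Rightarrow> bool" where
  "joinable_modulo E S u v \<longleftrightarrow> (\<exists>z z'. E z z' \<and> S\<^sup>*\<^sup>* u z \<and> S\<^sup>*\<^sup>* v z')"

lemma joinable_moduloI: "E z z' \<Longrightarrow> S\<^sup>*\<^sup>* u z \<Longrightarrow> S\<^sup>*\<^sup>* v z' \<Longrightarrow> joinable_modulo E S u v"
  unfolding joinable_modulo_def by blast

lemma joinable_moduloE:
  assumes "joinable_modulo E S u v"
  obtains z z' where "E z z'" "S\<^sup>*\<^sup>* u z" "S\<^sup>*\<^sup>* v z'"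
  using assms unfolding joinable_modulo_def by blast

text \<open>The first step of a reduction from \<open>y\<close> can be taken from \<open>x\<close>
  instead, because \<open>S\<close> absorbs \<open>E\<close> on the left. Only the empty reduction
  leaves \<open>x\<close> and \<open>z\<close> merely equivalent.\<close>

lemma rtranclp_modulo:
  assumes "equivp E" and "E OO S \<le> S"
    and "E x y" and "S\<^sup>*\<^sup>* y z"
  obtains z' where "S\<^sup>*\<^sup>* x z'" "E z' z"
  using assms(4)
proof (cases rule: converse_rtranclpE)
  case base
  show ?thesis
    using that[OF rtranclp.rtrancl_refl] \<open>E x y\<close> base by simp
next
  case (step y')
  have "S x y'"
    using assms(2) relcomppI[of E x y S y', OF \<open>E x y\<close> step(1)] by (rule predicate2D)
  then have "S\<^sup>*\<^sup>* x z"
    using step(2) by (rule converse_rtranclp_into_rtranclp)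
  then show ?thesis
    using equivp_reflp[OF assms(1)] by (rule that)
qed

lemma joinable_modulo_equiv:
  assumes E: "equivp E" and inv: "E OO S \<le> S"
    and "E u u'" and "E v v'" and "joinable_modulo E S u' v'"
  shows "joinable_modulo E S u v"
proof -
  obtain z z' where z: "E z z'" "S\<^sup>*\<^sup>* u' z" "S\<^sup>*\<^sup>* v' z'"
    using assms(5) by (rule joinable_moduloE)
  obtain a where "S\<^sup>*\<^sup>* u a" "E a z"
    using rtranclp_modulo[OF E inv \<open>E u u'\<close> z(2)] by blast
  moreover obtain b where "S\<^sup>*\<^sup>* v b" "E b z'"
    using rtranclp_modulo[OF E inv \<open>E v v'\<close> z(3)] by blast
  ultimately show ?thesis
    using z(1) E by (meson joinable_moduloI equivp_symp equivp_transp)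
qed

text \<open>Newman's induction with two equivalent starting points instead of one: local joinability
  yields only an equivalent pair, and the induction hypothesis has to apply to such a pair.\<close>

lemma newman_modulo:
  assumes wf: "wfp S\<inverse>\<inverse>" and E: "equivp E"
    and inv: "E OO S \<le> S"
    and local: "\<And>w u v. S w u \<Longrightarrow> S w v \<Longrightarrow> joinable_modulo E S u v"
    and "E w w'" and "S\<^sup>*\<^sup>* w u" and "S\<^sup>*\<^sup>* w' v"
  shows "joinable_modulo E S u v"
  using assms(5-)
proof (induction w arbitrary: w' u v rule: wfp_induct_rule[OF wfp_tranclp[OF wf]])
  case (1 w)
  \<comment> \<open>The induction is along \<open>S\<^sup>+\<^sup>+\<close> because the hypothesis
    is also used at a word that may lie several steps below \<open>w\<close>.\<close>
  have IH: "joinable_modulo E S u v"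
    if "S\<^sup>+\<^sup>+ w x" "E x x'" "S\<^sup>*\<^sup>* x u" "S\<^sup>*\<^sup>* x' v" for x x' u v
  proof (rule 1(1))
    show "S\<inverse>\<inverse>\<^sup>+\<^sup>+ x w"
      using that(1) by (simp add: tranclp_converse)
  qed (fact that)+
  have refl: "E x x" for x
    using E by (rule equivp_reflp)
  show ?case
  proof (cases "w = u")
    case True
    obtain z where "S\<^sup>*\<^sup>* w z" "E z v"
      using E inv 1(2,4) by (rule rtranclp_modulo)
    then show ?thesis
      using True joinable_moduloI[of E z v S u v] by simp
  next
    case False
    then obtain u1 where u1: "S w u1" "S\<^sup>*\<^sup>* u1 u"
      using 1(3) by (blast elim: converse_rtranclpE)
    show ?thesis
    proof (cases "w' = v")
      case True
      obtain z where "S\<^sup>*\<^sup>* w' z" "E z u"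
        using E inv equivp_symp[OF E 1(2)] 1(3) by (rule rtranclp_modulo)
      then show ?thesis
        using True equivp_symp[OF E] joinable_moduloI[of E u z S u v] by simp
    next
      case False
      then obtain v1 where "S w' v1" and v1_v: "S\<^sup>*\<^sup>* v1 v"
        using 1(4) by (blast elim: converse_rtranclpE)
      \<comment> \<open>Transferring the first step from \<open>w'\<close> to \<open>w\<close> makes
        both first steps start at the same point, as \<open>local\<close> requires.\<close>
      then have w_v1: "S w v1"
        by (intro predicate2D[OF inv relcomppI[of E w w' S v1, OF \<open>E w w'\<close>]])
      obtain z z' where z: "E z z'" "S\<^sup>*\<^sup>* u1 z" "S\<^sup>*\<^sup>* v1 z'"
        using local[OF u1(1) w_v1] by (rule joinable_moduloE)
      \<comment> \<open>The diagram is closed by three uses of \<open>IH\<close>: at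
        \<open>u1\<close> and at \<open>v1\<close> with a single starting point, and then at the
        equivalent pair \<open>z\<close>, \<open>z'\<close>.\<close>
      obtain s s' where s: "E s s'" "S\<^sup>*\<^sup>* u s" "S\<^sup>*\<^sup>* z s'"
        using IH[OF tranclp.r_into_trancl[of S, OF u1(1)] refl u1(2) z(2)] by (rule joinable_moduloE)
      obtain t t' where t: "E t t'" "S\<^sup>*\<^sup>* v t" "S\<^sup>*\<^sup>* z' t'"
        using IH[OF tranclp.r_into_trancl[of S, OF w_v1] refl v1_v z(3)] by (rule joinable_moduloE)
      have "S\<^sup>+\<^sup>+ w z"
        using u1(1) z(2) by (rule rtranclp_into_tranclp2)
      then have "joinable_modulo E S s' t'"
        using z(1) s(3) t(3) by (rule IH)
      then have "joinable_modulo E S s t"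
        by (rule joinable_modulo_equiv[where E = E, OF E inv s(1) t(1)])
      then obtain a b where "E a b" "S\<^sup>*\<^sup>* s a" "S\<^sup>*\<^sup>* t b"
        by (rule joinable_moduloE)
      then show ?thesis
        using s(2) t(2) by (meson joinable_moduloI rtranclp_trans)
    qed
  qed
qed

section \<open>Cyclic words\<close>

lemma cyclic_conjugate_append: "cyclic_conjugate (p @ q) (q @ p)"
  unfolding cyclic_conjugate_def by blast

lemma cyclic_conjugate_refl: "cyclic_conjugate u u"
  using cyclic_conjugate_append[of "[]" u] by simp

lemma cyclic_conjugate_sym: "cyclic_conjugate u v \<Longrightarrow> cyclic_conjugate v u"
  unfolding cyclic_conjugate_def by blast

text \<open>Rotations compose, so this form gives transitivity without comparing two factorisations
  of the middle word.\<close>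

lemma cyclic_conjugate_iff_rotate: "cyclic_conjugate u v \<longleftrightarrow> (\<exists>n. v = rotate n u)"
proof
  assume "cyclic_conjugate u v"
  then obtain p q where "u = p @ q" "v = q @ p"
    unfolding cyclic_conjugate_def by blast
  then have "v = rotate (length p) u"
    by (simp add: rotate_append)
  then show "\<exists>n. v = rotate n u" ..
next
  assume "\<exists>n. v = rotate n u"
  then obtain n where "v = rotate n u" ..
  then show "cyclic_conjugate u v"
    unfolding cyclic_conjugate_def
    by (metis append_take_drop_id rotate_drop_take)
qed

lemma cyclic_conjugate_trans:
  "cyclic_conjugate u v \<Longrightarrow> cyclic_conjugate v w \<Longrightarrow> cyclic_conjugate u w"
  unfolding cyclic_conjugate_iff_rotate by (metis rotate_rotate)

lemma equivp_cyclic_conjugate: "equivp cyclic_conjugate"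
  by (intro equivpI reflpI sympI transpI)
    (fact cyclic_conjugate_refl cyclic_conjugate_sym cyclic_conjugate_trans)+

lemma cyclic_step_conjugate: "cyclic_conjugate OO cyclic_step R \<le> cyclic_step R"
  unfolding cyclic_step_def
  by (intro predicate2I, elim relcomppE exE conjE)
    (meson cyclic_conjugate_sym cyclic_conjugate_trans)

lemma rstep_imp_cyclic_step: "rstep R u v \<Longrightarrow> cyclic_step R u v"
  unfolding cyclic_step_def using cyclic_conjugate_refl by blast

lemma rstep_context: "(l, r) \<in> R \<Longrightarrow> rstep R (p @ l @ q) (p @ r @ q)"
  unfolding rstep_def by blast

lemma cyclic_stepE:
  assumes "cyclic_step R w v"
  obtains l r q where "(l, r) \<in> R" "cyclic_conjugate w (l @ q)" "cyclic_conjugate v (r @ q)"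
proof -
  obtain p q l r where *: "(l, r) \<in> R" "cyclic_conjugate (p @ l @ q) w" "v = p @ r @ q"
    using assms unfolding cyclic_step_def rstep_def by blast
  have "cyclic_conjugate w (l @ q @ p)"
    using *(2) cyclic_conjugate_append[of p "l @ q"]
    by (metis append.assoc cyclic_conjugate_sym cyclic_conjugate_trans)
  moreover have "cyclic_conjugate v (r @ q @ p)"
    using *(3) cyclic_conjugate_append[of p "r @ q"] by simp
  ultimately show thesis
    using that *(1) by blast
qed

abbreviation cyclically_joinable :: "'a rewriting_system \<Rightarrow> 'a list \<Rightarrow> 'a list \<Rightarrow> bool" where
  "cyclically_joinable R \<equiv> joinable_modulo cyclic_conjugate (cyclic_step R)"

lemmas cyclically_joinable_conjugate =
  joinable_modulo_equiv[OF equivp_cyclic_conjugate cyclic_step_conjugate]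

lemma cyclically_joinableI_conjugate: "cyclic_conjugate u v \<Longrightarrow> cyclically_joinable R u v"
  by (rule joinable_moduloI) auto

lemma confluentp_imp_cyclically_joinable:
  assumes "confluentp (rstep R)" and "rstep R w u" and "rstep R w v"
  shows "cyclically_joinable R u v"
proof -
  obtain z where "(rstep R)\<^sup>*\<^sup>* u z" "(rstep R)\<^sup>*\<^sup>* v z"
    using assms by (meson confluentpD r_into_rtranclp)
  moreover have "(rstep R)\<^sup>*\<^sup>* \<le> (cyclic_step R)\<^sup>*\<^sup>*"
    by (intro rtranclp_mono) (auto intro: rstep_imp_cyclic_step)
  ultimately show ?thesis
    by (blast intro: joinable_moduloI cyclic_conjugate_refl)
qed

section \<open>Local confluence\<close>

text \<open>A tie, where the two cuts coincide, goes to \<open>prefix\<close>. Hence the overlap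
  \<open>d\<close> is non-empty in \<open>split\<close>, as the critical pairs below demand.\<close>

lemma append_eq_append_cases:
  assumes "u @ v = p @ q"
  obtains (prefix) c where "p = u @ c" "v = c @ q"
    | (split) d where "u = p @ d" "d \<noteq> []" "q = d @ v"
proof -
  from assms consider c where "p = u @ c" "v = c @ q" | d where "u = p @ d" "q = d @ v"
    unfolding append_eq_append_conv2 by metis
  then show thesis
    using that by cases (metis append_Nil append_Nil2)+
qed

lemma cyclic_critical_pair_conjugate:
  assumes overlap: "\<not> has_cyclical_overlap R" and incl: "\<not> has_cyclical_inclusion R"
    and rule1: "(x @ u @ y, r) \<in> R" and rule2: "(y @ v @ x, r') \<in> R"
    and "x \<noteq> []" and "y \<noteq> []"
  shows "cyclic_conjugate (r @ v) (r' @ u)"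
proof -
  have incl_eq: "cyclic_conjugate s s'"
    if "(l, s) \<in> R" "(l', s') \<in> R" "cyclic_conjugate l' l" for l l' s s'
    using incl that unfolding has_cyclical_inclusion_def by blast
  have incl_proper: "cyclic_conjugate s (t @ s')"
    if "(l, s) \<in> R" "(l', s') \<in> R" "cyclic_conjugate (t @ l') l" "t \<noteq> []" for l l' s s' t
    using incl that unfolding has_cyclical_inclusion_def by blast
  consider "u \<noteq> []" "v \<noteq> []" | "u = []" "v = []" | "u \<noteq> []" "v = []" | "u = []" "v \<noteq> []"
    by blast
  then show ?thesis
  proof cases
    case 1
    then show ?thesis
      using assms unfolding has_cyclical_overlap_def by blast
  next
    case 2
    then show ?thesis
      using incl_eq[OF rule1 rule2] cyclic_conjugate_append[of y x] by simp
  next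
    case 3
    \<comment> \<open>The second left-hand side is now \<open>y @ x\<close>, a proper suffix of the
      conjugate \<open>u @ y @ x\<close> of the first, so this is inclusion (b). The next case swaps
      the two rules.\<close>
    then have "cyclic_conjugate r (u @ r')"
      using incl_proper[OF rule1 rule2, of u] cyclic_conjugate_append[of "u @ y" x] by simp
    then show ?thesis
      using 3 cyclic_conjugate_trans[OF _ cyclic_conjugate_append] by simp
  next
    case 4
    then have "cyclic_conjugate r' (v @ r)"
      using incl_proper[OF rule2 rule1, of v] cyclic_conjugate_append[of "v @ x" y] by simp
    then show ?thesis
      using 4 cyclic_conjugate_sym[OF cyclic_conjugate_trans[OF _ cyclic_conjugate_append]] by simp
  qed
qed

lemma cyclically_joinable_redexes:
  assumes conf: "confluentp (rstep R)"
    and overlap: "\<not> has_cyclical_overlap R" and incl: "\<not> has_cyclical_inclusion R"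
    and rule1: "(l, r) \<in> R" and rule2: "(l', r') \<in> R"
    and "cyclic_conjugate (l @ q) (l' @ q')"
  shows "cyclically_joinable R (r @ q) (r' @ q')"
proof -
  obtain a b where ab: "l @ q = a @ b" "l' @ q' = b @ a"
    using assms(6) unfolding cyclic_conjugate_def by blast
  consider (first_uncut) c where "a = l @ c" "q = c @ b"
    | (first_cut) d where "l = a @ d" "d \<noteq> []" "b = d @ q"
    using ab(1) by (rule append_eq_append_cases)
  then show ?thesis
  proof cases
    case first_uncut
    \<comment> \<open>The circle is cut at the start of \<open>l'\<close>. The word read from there
      is \<open>b @ l @ c = l' @ q'\<close>, which contains both redexes.\<close>
    have "rstep R (b @ l @ c) (b @ r @ c)" "rstep R (b @ l @ c) (r' @ q')"
      using rstep_context[OF rule1] rstep_context[OF rule2, of "[]" q'] ab(2) first_uncut by auto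
    then have "cyclically_joinable R (b @ r @ c) (r' @ q')"
      by (rule confluentp_imp_cyclically_joinable[OF conf])
    moreover have "cyclic_conjugate (r @ q) (b @ r @ c)"
      using cyclic_conjugate_append[of "r @ c" b] first_uncut by simp
    ultimately show ?thesis
      by (meson cyclically_joinable_conjugate cyclic_conjugate_refl)
  next
    case first_cut
    then have "l' @ q' = (d @ q) @ a"
      using ab(2) by simp
    then consider (second_uncut) e where "d @ q = l' @ e" "q' = e @ a"
      | (both_cut) x where "l' = (d @ q) @ x" "x \<noteq> []" "a = x @ q'"
      by (rule append_eq_append_cases)
    then show ?thesis
    proof cases
      case second_uncut
      \<comment> \<open>Now the cut is at the start of \<open>l\<close>: since
        \<open>l @ q = a @ l' @ e\<close>, this word contains both redexes.\<close>
      then have "rstep R (l @ q) (r @ q)" "rstep R (l @ q) (a @ r' @ e)"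
        using rstep_context[OF rule1, of "[]" q] rstep_context[OF rule2, of a e] first_cut by auto
      then have "cyclically_joinable R (r @ q) (a @ r' @ e)"
        by (rule confluentp_imp_cyclically_joinable[OF conf])
      moreover have "cyclic_conjugate (r' @ q') (a @ r' @ e)"
        using cyclic_conjugate_append[of "r' @ e" a] second_uncut by simp
      ultimately show ?thesis
        by (meson cyclically_joinable_conjugate cyclic_conjugate_refl)
    next
      case both_cut
      \<comment> \<open>The arcs meet in \<open>d\<close>, where \<open>l\<close> ends and
        \<open>l'\<close> starts, and in \<open>x\<close>, where \<open>l'\<close> ends and
        \<open>l\<close> starts. What each arc covers alone is the remainder \<open>q'\<close> or
        \<open>q\<close> of the other.\<close>
      then have "(x @ q' @ d, r) \<in> R" "(d @ q @ x, r') \<in> R"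
        using rule1 rule2 first_cut by simp_all
      then show ?thesis
        using cyclic_critical_pair_conjugate[OF overlap incl] both_cut(2) first_cut(2)
        by (blast intro: cyclically_joinableI_conjugate)
    qed
  qed
qed

lemma cyclic_step_locally_confluent:
  assumes "confluentp (rstep R)" and "\<not> has_cyclical_overlap R" and "\<not> has_cyclical_inclusion R"
    and "cyclic_step R w u" and "cyclic_step R w v"
  shows "cyclically_joinable R u v"
proof -
  obtain l r q where 1: "(l, r) \<in> R" "cyclic_conjugate w (l @ q)" "cyclic_conjugate u (r @ q)"
    using assms(4) by (rule cyclic_stepE)
  obtain l' r' q' where 2: "(l', r') \<in> R" "cyclic_conjugate w (l' @ q')" "cyclic_conjugate v (r' @ q')"
    using assms(5) by (rule cyclic_stepE)
  have "cyclic_conjugate (l @ q) (l' @ q')"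
    using 1(2) 2(2) by (meson cyclic_conjugate_sym cyclic_conjugate_trans)
  then have "cyclically_joinable R (r @ q) (r' @ q')"
    by (rule cyclically_joinable_redexes[OF assms(1-3) 1(1) 2(1)])
  with 1(3) 2(3) show ?thesis
    by (rule cyclically_joinable_conjugate)
qed

theorem theorem5p11:
  fixes R :: "'a rewriting_system"
  assumes "complete_system R"
    and "reduced_system R"
    and "cyclically_terminating R"
    and "\<not> has_cyclical_overlap R"
    and "\<not> has_cyclical_inclusion R"
  shows "cyclically_confluent R"
proof -
  have conf: "confluentp (rstep R)"
    using assms(1) unfolding complete_system_def by blast
  have wf: "wfp (cyclic_step R)\<inverse>\<inverse>"
    using assms(3) unfolding cyclically_terminating_def no_infinite_chain_def
    by (simp add: wfp_def wf_iff_no_infinite_down_chain)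
  have "cyclically_joinable R u v"
    if "(cyclic_step R)\<^sup>*\<^sup>* w u" "(cyclic_step R)\<^sup>*\<^sup>* w v" for w u v
    using newman_modulo[OF wf equivp_cyclic_conjugate cyclic_step_conjugate
        cyclic_step_locally_confluent[OF conf assms(4,5)] cyclic_conjugate_refl that] .
  then show ?thesis
    unfolding cyclically_confluent_def joinable_modulo_def by blast
qed

end
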